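(* Let $h\ge1$ and let $B=(2-2h)$ be the one-by-one matrix with single entry $2-2h$, considered as a framing of the genus-one canoe. Let $Q$ be the quiver with one node and $h$ arrows (loops), and for a partition $\lambda$ let $A_\lambda(q)$ be the refined Kac polynomial of $Q$. Then for every $d\ge1$, $$A_{1^d}(1)=n^{(B)}_d,$$ where $1^d=(1,1,\dots,1)$ and $n^{(B)}_d$ are the Ooguri–Vafa disk integers of the genus-one canoe in framing $B$.
   Context: Integers $n^{(B)}_d$. For an integer $p$, the wavefunction of the genus-one canoe in framing $A=(p)$ is the formal power series $$\Psi^{(p)}(X)=\sum_{v\ge0}\frac{q^{(1-p)v^2}}{\prod_{i=1}^v(1-q^{2i})}X^v\in\mathbb{Z}((q))[[X]].$$ With $(x;q^2)_\infty=\prod_{n\ge0}(1-q^{2n}x)$, write it (uniquely) as $$\Psi^{(p)}(X)=\prod_{d\ge1}\prod_{k\in\mathbb{Z}}\big((-q)^kX^d;q^2\big)_\infty^{n^{(p)}_{d,k}},$$ where the $n^{(p)}_{d,k}$ are integers, finitely many nonzero for each $d$, and set $n^{(p)}_d=\sum_kn^{(p)}_{d,k}$. Equivalently, $W^{(p)}(X)=\sum_{d\ge1}n^{(p)}_d\,\mathrm{Li}_2(X^d)$ is the limit of $(q^2-1)\log\Psi^{(p)}$ as $q\to-1$. Here $p=2-2h$ and $n^{(B)}_d:=n^{(2-2h)}_d$. Refined Kac polynomials (Rodriguez-Villegas). The Kac polynomial $A_d(q)$ counts isomorphism classes of absolutely indecomposable $d$-dimensional representations of $Q$ over $\mathbb{F}_q$.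 It is refined by polynomials $A_\lambda(q)$ indexed by partitions, with $A_d(q)=\sum_{|\lambda|=d}A_\lambda(q)$, as follows. For a partition $\lambda$ with $m_i$ parts equal to $i$, let $\langle\lambda,\lambda\rangle=\sum_i(\lambda_i')^2$ where $\lambda'$ is the conjugate partition, $b_\lambda(q)=\prod_i\prod_{j=1}^{m_i}(1-q^j)$, and $T^\lambda=\prod_iT_i^{m_i}$ for variables $T_1,T_2,\dots$. Then the $A_\lambda(q)$ are defined by $$\sum_\lambda\frac{q^{(h-1)\langle\lambda,\lambda\rangle}}{b_\lambda(q^{-1})}T^\lambda=\mathrm{Exp}\Big(\frac{1}{q-1}\sum_{\lambda\neq\emptyset}A_\lambda(q)T^\lambda\Big),$$ where $\mathrm{Exp}(f)=\exp\big(\sum_{n\ge1}\tfrac1n f(q^n,T_1^n,T_2^n,\dots)\big)$ is the plethystic exponential. *)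

theory Defs
  imports "HOL-Computational_Algebra.Computational_Algebra" "HOL-Library.Multiset"
begin

(* Coefficients live in the field Q((q)) = "rat fls", with q = fls_X.  It contains both Z((q)) and,
   by expansion at q = 0, the field Q(q); the substitution q -> q^n is fls_compose_power _ n. *)

definition canoe_wavefunction :: "int \<Rightarrow> rat fls fps" where
  "canoe_wavefunction p =
     Abs_fps (\<lambda>v. fls_X powi ((1 - p) * (int v)\<^sup>2) / (\<Prod>i=1..v. 1 - fls_X ^ (2 * i)))"

(* (x; q^2)_infinity.  The limit is taken coefficientwise in X, each coefficient converging for the
   q-adic metric that the library puts on Laurent series.  (The metric on "rat fls fps" itself is
   X-adic with discrete coefficients, and this product does not converge for it.) *)
definition q2_pochhammer_inf :: "rat fls fps \<Rightarrow> rat fls fps" where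
  "q2_pochhammer_inf x =
     Abs_fps (\<lambda>j. lim (\<lambda>N. fps_nth (\<Prod>n<N. 1 - fps_const (fls_X ^ (2 * n)) * x) j))"

(* n d k is the exponent of ((-q)^k X^d; q^2)_infinity.  The clause on n 0 only normalises the
   unused row d = 0, so that n is unique as a function. *)
definition is_disk_exponents :: "int \<Rightarrow> (nat \<Rightarrow> int \<Rightarrow> int) \<Rightarrow> bool" where
  "is_disk_exponents p n \<longleftrightarrow>
     (\<forall>k. n 0 k = 0) \<and>
     (\<forall>d. finite {k. n d k \<noteq> 0}) \<and>
     (\<forall>j. (\<lambda>D. fps_nth
              (\<Prod>d=1..D. \<Prod>k | n d k \<noteq> 0.
                 q2_pochhammer_inf (fps_const ((- fls_X) powi k) * fps_X ^ d) powi (n d k)) j)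
          \<longlonglongrightarrow> fps_nth (canoe_wavefunction p) j)"

definition disk_exponent :: "int \<Rightarrow> nat \<Rightarrow> int \<Rightarrow> int" where
  "disk_exponent p = (THE n. is_disk_exponents p n)"

definition disk_integer :: "int \<Rightarrow> nat \<Rightarrow> int" where
  "disk_integer p d = (\<Sum>k | disk_exponent p d k \<noteq> 0. disk_exponent p d k)"

(* A partition is the multiset of its parts (all nonzero), and F :: nat multiset => rat fls stands
   for the formal series with coefficient F l at the monomial T^l.  Since T^l T^m = T^(l + m), the
   product of series is the convolution below. *)
definition is_partition :: "nat multiset \<Rightarrow> bool" where
  "is_partition l \<longleftrightarrow> 0 \<notin># l"

type_synonym tseries = "nat multiset \<Rightarrow> rat fls"

definition tseries_mult :: "tseries \<Rightarrow> tseries \<Rightarrow> tseries" where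
  "tseries_mult F G = (\<lambda>l. \<Sum>m | m \<subseteq># l. F m * G (l - m))"

primrec tseries_power :: "tseries \<Rightarrow> nat \<Rightarrow> tseries" where
  "tseries_power F 0 = (\<lambda>l. if l = {#} then 1 else 0)"
| "tseries_power F (Suc k) = tseries_mult F (tseries_power F k)"

(* exp F for F with zero constant term: F^k has no monomial with fewer than k factors. *)
definition tseries_exp :: "tseries \<Rightarrow> tseries" where
  "tseries_exp F = (\<lambda>l. \<Sum>k\<le>size l. tseries_power F k l / fact k)"

(* F(q^n, T_1^n, T_2^n, ...) for n > 0; at most one m contributes. *)
definition adams :: "nat \<Rightarrow> tseries \<Rightarrow> tseries" where
  "adams n F = (\<lambda>l. \<Sum>m | repeat_mset n m = l. fls_compose_power (F m) n)"

(* Plethystic exponential of a series with zero constant term: the n-th Adams operation only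
   contributes to monomials whose number of factors is a multiple of n, hence n <= size l. *)
definition plethystic_Exp :: "tseries \<Rightarrow> tseries" where
  "plethystic_Exp F = tseries_exp (\<lambda>l. \<Sum>n=1..size l. adams n F l / of_nat n)"

definition conjugate_part :: "nat multiset \<Rightarrow> nat \<Rightarrow> nat" where
  "conjugate_part l i = size (filter_mset (\<lambda>x. i \<le> x) l)"

(* <l, l>; the conjugate parts with index beyond the weight of l vanish. *)
definition partition_norm :: "nat multiset \<Rightarrow> nat" where
  "partition_norm l = (\<Sum>i=1..sum_mset l. (conjugate_part l i)\<^sup>2)"

definition b_partition :: "nat multiset \<Rightarrow> rat fls \<Rightarrow> rat fls" where
  "b_partition l x = (\<Prod>i\<in>set_mset l. \<Prod>j=1..count l i. 1 - x ^ j)"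

(* The identity determines A l for every nonempty partition l; the values of A at the empty
   partition and at multisets containing 0 are irrelevant. *)
definition is_refined_Kac_polynomials :: "nat \<Rightarrow> (nat multiset \<Rightarrow> rat poly) \<Rightarrow> bool" where
  "is_refined_Kac_polynomials h A \<longleftrightarrow>
     (\<forall>l. is_partition l \<longrightarrow>
        fls_X powi ((int h - 1) * int (partition_norm l)) / b_partition l (inverse fls_X) =
        plethystic_Exp
          (\<lambda>m. if m = {#} then 0 else fps_to_fls (fps_of_poly (A m)) / (fls_X - 1)) l)"

end

theory Submission
  imports Defs
begin

text \<open>
  Set all \<open>T\<^sub>i\<close> with \<open>i \<noteq> 1\<close> to zero in the defining identity of the refined Kac polynomials.  Since
  \<open>(2h - 1)v\<^sup>2 = 2(h - 1)v\<^sup>2 + v\<^sup>2\<close>, replacing \<open>q\<close> by \<open>q\<^sup>2\<close> and \<open>T\<^sub>1\<close> by \<open>-X/q\<close> turns its left-hand side into the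
  wave function in framing \<open>2 - 2h\<close>, and its right-hand side into the product of the factors
  \<open>((-q)\<^bsup>2i-d\<^esup>X\<^sup>d; q\<^sup>2)\<^sub>\<infinity>\<close> raised to the \<open>i\<close>-th coefficient of \<open>A\<^bsub>1^d\<^esub>\<close>.  All product expansions are compared through
  logarithmic derivatives.  That the coefficients are integers follows by induction on \<open>d\<close>: the wave
  function and the factors of degree less than \<open>d\<close> have coefficients in \<open>\<int>((q))\<close>, hence so does the first
  term in which they differ.
\<close>

unbundle fps_syntax

section \<open>Logarithmic derivatives of formal power series\<close>

text \<open>This is X d/dX applied to log F, without a logarithm having to be formed. The factor X
  preserves degrees: for constant term 1, coefficient v is v times that of log F.\<close>

definition fps_logder :: "'a::field_char_0 fps \<Rightarrow> 'a fps" where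
  "fps_logder F = fps_X * fps_deriv F * inverse F"

lemma fps_logder_mult_self:
  assumes "F $ 0 \<noteq> 0"
  shows "fps_logder F * F = fps_X * fps_deriv F"
  using inverse_mult_eq_1[OF assms] by (simp add: fps_logder_def mult.assoc)

lemma fps_logder_eqI:
  assumes "F $ 0 \<noteq> 0" and "L * F = fps_X * fps_deriv F"
  shows "fps_logder F = L"
  using inverse_mult_eq_1'[OF assms(1)]
  by (simp add: fps_logder_def mult.assoc flip: assms(2))

lemma fps_logder_1 [simp]: "fps_logder 1 = 0"
  by (simp add: fps_logder_def)

lemma fps_logder_nth_0 [simp]: "fps_logder F $ 0 = 0"
  by (simp add: fps_logder_def)

lemma fps_logder_mult:
  assumes "F $ 0 \<noteq> 0" "G $ 0 \<noteq> 0"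
  shows "fps_logder (F * G) = fps_logder F + fps_logder G"
proof (rule fps_logder_eqI)
  have "(fps_logder F + fps_logder G) * (F * G)
      = (fps_logder F * F) * G + F * (fps_logder G * G)"
    by (simp add: algebra_simps)
  also have "\<dots> = fps_X * fps_deriv (F * G)"
    unfolding fps_logder_mult_self[OF assms(1)] fps_logder_mult_self[OF assms(2)]
    by (simp add: algebra_simps)
  finally show "(fps_logder F + fps_logder G) * (F * G) = fps_X * fps_deriv (F * G)" .
qed (use assms in simp)

lemma fps_logder_power:
  assumes "F $ 0 \<noteq> 0"
  shows "fps_logder (F ^ n) = of_nat n * fps_logder F"
  using assms by (induction n) (simp_all add: fps_logder_mult algebra_simps)

lemma fps_logder_inverse:
  assumes "F $ 0 \<noteq> 0"
  shows "fps_logder (inverse F) = - fps_logder F"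
proof -
  have "fps_logder (inverse F * F) = fps_logder (inverse F) + fps_logder F"
    using assms by (intro fps_logder_mult) auto
  with assms show ?thesis by (simp add: inverse_mult_eq_1 eq_neg_iff_add_eq_0)
qed

lemma fps_logder_power_int:
  assumes "F $ 0 \<noteq> 0"
  shows "fps_logder (F powi n) = of_int n * fps_logder F"
  using assms by (simp add: power_int_def fps_logder_power fps_logder_inverse)

lemma fps_prod_nth0: "(\<Prod>i\<in>I. F i :: 'a::comm_ring_1 fps) $ 0 = (\<Prod>i\<in>I. F i $ 0)"
  by (induction I rule: infinite_finite_induct) simp_all

lemma fps_logder_prod:
  assumes "\<And>i. i \<in> I \<Longrightarrow> F i $ 0 \<noteq> 0"
  shows "fps_logder (\<Prod>i\<in>I. F i) = (\<Sum>i\<in>I. fps_logder (F i))"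
  using assms
  by (induction I rule: infinite_finite_induct) (simp_all add: fps_logder_mult fps_prod_nth0)

text \<open>Comparing coefficients in X F' = F * \<open>fps_logder F\<close> gives a Newton-type
  recursion; the summand i = n drops out because the logarithmic derivative has constant term
  0.\<close>

lemma of_nat_mult_fps_nth_logder:
  assumes "F $ 0 = 1"
  shows "of_nat n * F $ n = (\<Sum>i<n. F $ i * fps_logder F $ (n - i))"
proof -
  have "of_nat n * F $ n = (fps_X * fps_deriv F) $ n"
    by (cases n) (simp_all del: of_nat_Suc)
  also have "\<dots> = (F * fps_logder F) $ n"
    using fps_logder_mult_self[of F] assms by (simp add: mult.commute)
  also have "\<dots> = (\<Sum>i\<le>n. F $ i * fps_logder F $ (n - i))"
    by (simp add: fps_mult_nth atLeast0AtMost)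
  also have "\<dots> = (\<Sum>i<n. F $ i * fps_logder F $ (n - i))"
    by (simp add: lessThan_Suc_atMost [symmetric])
  finally show ?thesis .
qed

text \<open>The recursion computes coefficient n from earlier ones after division by n, which
  characteristic 0 permits.\<close>

lemma fps_nth_eq_if_logder_eq:
  assumes "F $ 0 = 1" "G $ 0 = 1"
    and "\<And>v. v \<le> n \<Longrightarrow> fps_logder F $ v = fps_logder G $ v"
  shows "F $ n = G $ n"
  using assms(3)
proof (induction n rule: less_induct)
  case (less n)
  show ?case
  proof (cases "n = 0")
    case False
    have "of_nat n * F $ n = of_nat n * G $ n"
      unfolding of_nat_mult_fps_nth_logder[OF assms(1)] of_nat_mult_fps_nth_logder[OF assms(2)]
      using less by (intro sum.cong) simp_all
    with False show ?thesis by simp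
  qed (simp add: assms)
qed

text \<open>Below n the series agree, so subtracting the two recursions at n leaves only the summand
  i = 0, where \<open>F $ 0\<close> is 1. This reads off the first discrepancy of two
  products.\<close>

lemma fps_nth_diff_eq_logder_diff:
  assumes "F $ 0 = 1" "G $ 0 = 1"
    and "\<And>v. v < n \<Longrightarrow> fps_logder F $ v = fps_logder G $ v"
  shows "of_nat n * (F $ n - G $ n) = fps_logder F $ n - fps_logder G $ n"
proof (cases "n = 0")
  case False
  have eq: "F $ i = G $ i" if "i < n" for i
    by (rule fps_nth_eq_if_logder_eq[OF assms(1,2)], rule assms(3)) (use that in linarith)
  have "of_nat n * (F $ n - G $ n) =
      (\<Sum>i<n. F $ i * fps_logder F $ (n - i)) - (\<Sum>i<n. G $ i * fps_logder G $ (n - i))"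
    using of_nat_mult_fps_nth_logder[OF assms(1), of n] of_nat_mult_fps_nth_logder[OF assms(2), of n]
    by (simp only: right_diff_distrib)
  also have "\<dots> = (\<Sum>i<n. F $ i * (fps_logder F $ (n - i) - fps_logder G $ (n - i)))"
    unfolding sum_subtractf[symmetric]
    by (intro sum.cong refl) (simp add: eq right_diff_distrib)
  also have "\<dots> = (\<Sum>i\<in>{0}. F $ i * (fps_logder F $ (n - i) - fps_logder G $ (n - i)))"
    using False by (intro sum.mono_neutral_right) (auto simp: assms(3))
  finally show ?thesis using assms(1) by simp
qed simp

section \<open>Substituting a monomial for X\<close>

lemma fps_nth_compose_monomial:
  fixes f :: "'a::field fps"
  assumes "d > 0"
  shows "(f oo fps_const c * fps_X ^ d) $ n = (if d dvd n then f $ (n div d) * c ^ (n div d) else 0)"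
proof -
  have "fps_const c * fps_X ^ d = (fps_const c * fps_X) oo fps_X ^ d"
    using assms by (simp add: fps_compose_mult_distrib)
  hence "f oo fps_const c * fps_X ^ d = (f oo fps_const c * fps_X) oo fps_X ^ d"
    using assms by (simp add: fps_compose_assoc)
  thus ?thesis using assms by (simp add: fps_nth_compose_X_power fps_compose_linear)
qed

text \<open>Chain rule: X d/dX multiplies the substituted monomial by d.\<close>

lemma fps_logder_compose_monomial:
  fixes F :: "'a::field_char_0 fps"
  assumes "F $ 0 \<noteq> 0" and "d > 0"
  shows "fps_logder (F oo fps_const c * fps_X ^ d)
       = of_nat d * (fps_logder F oo fps_const c * fps_X ^ d)"
proof (rule fps_logder_eqI)
  let ?x = "fps_const c * fps_X ^ d"
  have x0: "?x $ 0 = 0" using assms by simp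
  have X: "fps_X * fps_deriv ?x = of_nat d * ?x"
  proof (rule fps_ext)
    show "(fps_X * fps_deriv ?x) $ n = (of_nat d * ?x) $ n" for n
      by (cases n) (simp_all add: fps_X_power_iff del: of_nat_Suc flip: fps_of_nat)
  qed
  have "fps_X * fps_deriv (F oo ?x) = (fps_X * fps_deriv ?x) * (fps_deriv F oo ?x)"
    unfolding fps_compose_deriv[OF x0] by (simp only: mult_ac)
  also have "\<dots> = of_nat d * (?x * (fps_deriv F oo ?x))"
    unfolding X by (simp only: mult_ac)
  also have "?x * (fps_deriv F oo ?x) = (fps_X * fps_deriv F) oo ?x"
    using x0 by (simp add: fps_compose_mult_distrib)
  also have "\<dots> = (fps_logder F oo ?x) * (F oo ?x)"
    using x0 assms by (simp add: fps_compose_mult_distrib flip: fps_logder_mult_self)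
  finally show "of_nat d * (fps_logder F oo ?x) * (F oo ?x) = fps_X * fps_deriv (F oo ?x)"
    by (simp add: mult.assoc)
qed (use assms in simp)

text \<open>The recursion for the inverse involves no division since \<open>F $ 0\<close> is 1. It
  serves both for the integers inside the rationals and for \<open>int_fls\<close>.\<close>

lemma fps_inverse_nth_in_subring:
  fixes F :: "'a::field fps"
  assumes F0: "F $ 0 = 1" and F: "\<And>n. F $ n \<in> S"
    and S: "0 \<in> S" "1 \<in> S" "\<And>x. x \<in> S \<Longrightarrow> - x \<in> S"
      "\<And>x y. x \<in> S \<Longrightarrow> y \<in> S \<Longrightarrow> x + y \<in> S" "\<And>x y. x \<in> S \<Longrightarrow> y \<in> S \<Longrightarrow> x * y \<in> S"
  shows "inverse F $ n \<in> S"
proof (induction n rule: less_induct)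
  case (less n)
  have sum_closed: "sum g I \<in> S" if "\<And>i. i \<in> I \<Longrightarrow> g i \<in> S" for g :: "nat \<Rightarrow> 'a" and I
    using that by (induction I rule: infinite_finite_induct) (auto intro: S)
  show ?case
  proof (cases "n = 0")
    case False
    have "(\<Sum>i\<le>n. F $ i * inverse F $ (n - i)) = (F * inverse F) $ n"
      by (simp add: fps_mult_nth atLeast0AtMost)
    also have "\<dots> = 0" using F0 False by (simp add: inverse_mult_eq_1')
    finally have "inverse F $ n = - (\<Sum>i\<in>{..n} - {0}. F $ i * inverse F $ (n - i))"
      using F0 by (simp add: sum.remove[of _ 0] eq_neg_iff_add_eq_0)
    also have "\<dots> \<in> S"
      using False by (intro S sum_closed F less) auto
    finally show ?thesis .
  qed (use F0 S in simp)
qed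

section \<open>The infinite Pochhammer symbol\<close>

abbreviation q :: "rat fls" where "q \<equiv> fls_X"

section \<open>The subring Z((q)) of Q((q))\<close>

definition int_fls :: "rat fls set" where
  "int_fls = {f. \<forall>n. f $$ n \<in> \<int>}"

lemma int_flsD: "f \<in> int_fls \<Longrightarrow> f $$ n \<in> \<int>"
  by (simp add: int_fls_def)

lemma int_fls_0 [intro]: "0 \<in> int_fls"
  and int_fls_1 [intro]: "1 \<in> int_fls"
  and int_fls_X [intro]: "fls_X \<in> int_fls"
  by (auto simp: int_fls_def)

lemma int_fls_add [intro]: "f \<in> int_fls \<Longrightarrow> g \<in> int_fls \<Longrightarrow> f + g \<in> int_fls"
  and int_fls_diff [intro]: "f \<in> int_fls \<Longrightarrow> g \<in> int_fls \<Longrightarrow> f - g \<in> int_fls"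
  and int_fls_minus [intro]: "f \<in> int_fls \<Longrightarrow> - f \<in> int_fls"
  by (auto simp: int_fls_def)

lemma int_fls_mult [intro]: "f \<in> int_fls \<Longrightarrow> g \<in> int_fls \<Longrightarrow> f * g \<in> int_fls"
  by (auto simp: int_fls_def fls_times_nth(1) intro!: Ints_sum Ints_mult)

lemma int_fls_prod [intro]: "(\<And>i. i \<in> I \<Longrightarrow> f i \<in> int_fls) \<Longrightarrow> prod f I \<in> int_fls"
  by (induction I rule: infinite_finite_induct) auto

lemma int_fls_sum [intro]: "(\<And>i. i \<in> I \<Longrightarrow> f i \<in> int_fls) \<Longrightarrow> sum f I \<in> int_fls"
  by (induction I rule: infinite_finite_induct) auto

lemma int_fls_power [intro]: "f \<in> int_fls \<Longrightarrow> f ^ n \<in> int_fls"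
  by (induction n) auto

lemma minus_fls_X_powi:
  "(- fls_X :: 'a::field fls) powi n = fls_const ((- 1) powi n) * fls_X_intpow n"
proof -
  have c: "fls_const c powi n = fls_const (c powi n)" for c :: 'a
    by (simp add: power_int_def fls_const_power fls_inverse_const)
  have "(- fls_X :: 'a fls) = fls_const (- 1) * fls_X"
    by (simp add: fls_const_uminus [symmetric])
  thus ?thesis by (simp only: power_int_mult_distrib c fls_X_power_int)
qed

lemma int_fls_minus_X_powi [intro]: "(- q) powi n \<in> int_fls"
proof -
  have "(- 1 :: rat) powi n \<in> \<int>"
    by (simp add: power_int_minus_left)
  thus ?thesis by (auto simp: int_fls_def minus_fls_X_powi)
qed

lemma int_fls_X_powi [intro]: "q powi n \<in> int_fls"
  by (auto simp: int_fls_def fls_X_power_int)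

lemma one_minus_q_power_nonzero: "k > 0 \<Longrightarrow> (1 :: 'a::field fls) - fls_X ^ k \<noteq> 0"
proof
  assume "k > 0" "(1 :: 'a fls) - fls_X ^ k = 0"
  hence "((1 :: 'a fls) - fls_X ^ k) $$ 0 = 0" by simp
  with \<open>k > 0\<close> show False by simp
qed

lemma inverse_one_minus_q_power:
  assumes "k > 0"
  shows "inverse (1 - q ^ k) = fps_to_fls (inverse (1 - fps_X ^ k))"
proof -
  have "subdegree (1 - fps_X ^ k :: rat fps) = 0"
    using assms by (intro subdegreeI) auto
  thus ?thesis by (simp add: fls_inverse_fps_to_fls [symmetric] fps_to_fls_power)
qed

lemma int_fls_inverse_one_minus_q_power [intro]:
  assumes "k > 0"
  shows "inverse (1 - q ^ k) \<in> int_fls"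
proof -
  have "inverse (1 - fps_X ^ k :: rat fps) $ n \<in> \<int>" for n
    using assms by (intro fps_inverse_nth_in_subring) auto
  thus ?thesis using assms by (simp add: inverse_one_minus_q_power int_fls_def)
qed

text \<open>The error has q-order at least N, up to the fixed order of s. The factor s will be the
  scalar produced by substituting a monomial for X.\<close>

lemma fls_tendstoI:
  fixes s :: "'a::field fls"
  assumes "\<And>N. f N = L + fls_X ^ N * fps_to_fls (r N)"
  shows "(\<lambda>N. s * f N) \<longlonglongrightarrow> s * L"
proof (rule metric_LIMSEQ_I)
  fix e :: real assume "e > 0"
  then obtain M where M: "(1 / 2) ^ M < e"
    using real_arch_pow_inv[of e "1/2"] by auto
  \<comment> \<open>A pole of s lowers the order of the error, so the threshold is raised by the
    pole order.\<close>
  have "dist (s * f N) (s * L) < e" if N: "N \<ge> M + nat (- fls_subdegree s)" for N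
  proof (cases "s * f N = s * L")
    case False
    have eq: "s * f N - s * L = s * (fls_X ^ N * fps_to_fls (r N))"
      by (simp add: assms algebra_simps)
    with False have nz: "s \<noteq> 0" "r N \<noteq> 0" by auto
    have "fls_subdegree (s * f N - s * L) = fls_subdegree s + (N + subdegree (r N))"
      using nz by (simp add: eq fls_subdegree_fls_to_fps)
    with N have *: "fls_subdegree (s * f N - s * L) \<ge> int M" by linarith
    hence "dist (s * f N) (s * L) = (1 / 2) ^ nat (fls_subdegree (s * f N - s * L))"
      using False by (simp add: dist_fls_def power_one_over inverse_eq_divide)
    also have "\<dots> \<le> (1 / 2) ^ M"
      using * by (intro power_decreasing) auto
    finally show ?thesis using M by simp
  qed (use \<open>e > 0\<close> in \<open>simp only: dist_self\<close>)
  thus "\<exists>N0. \<forall>N\<ge>N0. dist (s * f N) (s * L) < e" by blast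
qed

text \<open>Euler's coefficients (-1)^j q^(j(j-1)) / ((1-q^2)(1-q^4)...(1-q^(2j))), given through
  their ratio.\<close>

primrec q2_pochhammer_coeff :: "nat \<Rightarrow> rat fls" where
  "q2_pochhammer_coeff 0 = 1"
| "q2_pochhammer_coeff (Suc j) = - (q ^ (2 * j)) * inverse (1 - q ^ (2 * Suc j)) * q2_pochhammer_coeff j"

definition q2_pochhammer_series :: "rat fls fps" where
  "q2_pochhammer_series = Abs_fps q2_pochhammer_coeff"

lemma q2_pochhammer_series_nth_0 [simp]: "q2_pochhammer_series $ 0 = 1"
  by (simp add: q2_pochhammer_series_def)

lemma int_fls_q2_pochhammer_coeff: "q2_pochhammer_coeff j \<in> int_fls"
  proof (induction j)
  case (Suc j)
  show ?case
    unfolding q2_pochhammer_coeff.simps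
    by (intro int_fls_mult int_fls_minus int_fls_power int_fls_X int_fls_inverse_one_minus_q_power Suc) simp
qed auto

text \<open>The ratio of successive coefficients in the q-binomial theorem, with denominators
  cleared. The induction rests on P(N+1) = (1 - q^(2N) X) P(N).\<close>

lemma finite_q2_pochhammer_nth_Suc:
  fixes j N :: nat
  defines "P \<equiv> \<lambda>N. \<Prod>n<N. 1 - fps_const (q ^ (2 * n)) * fps_X"
  shows "P N $ Suc j * (1 - q ^ (2 * Suc j)) = P N $ j * (q ^ (2 * N) - q ^ (2 * j))"
proof (induction N arbitrary: j)
  case 0
  show ?case by (simp add: P_def)
next
  case (Suc N)
  have P_Suc: "P (Suc N) = P N - fps_const (q ^ (2 * N)) * (fps_X * P N)"
    by (simp add: P_def algebra_simps)
  have 1: "P N $ j * (1 - q ^ (2 * j)) = (fps_X * P N) $ j * (q ^ (2 * N) - q ^ (2 * (j - 1)))"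
    using Suc.IH[of "j - 1"] by (cases j) simp_all
  have 2: "(fps_X * P N) $ j * q ^ (2 * (j - 1)) * q ^ 2 = (fps_X * P N) $ j * q ^ (2 * j)"
    by (cases j) (simp_all add: power2_eq_square)
  \<comment> \<open>The induction step as pure algebra: a1, a0, am are the coefficients of
    \<open>P N\<close> at j+1, j, j-1, and Q, u, w, t stand for q^(2N), q^(2(j-1)), q^(2j), q^2. The
    relation u t = w is assumed only after multiplication by am, because at j = 0 truncated
    subtraction breaks it while am is 0.\<close>
  have step: "(a1 - Q * a0) * (1 - w * t) = (a0 - Q * am) * (Q * t - w)"
    if "a1 * (1 - w * t) = a0 * (Q - w)" "a0 * (1 - w) = am * (Q - u)" "am * u * t = am * w"
    for a1 a0 am Q u w t :: "rat fls"
  proof -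
    have "(a1 - Q * a0) * (1 - w * t) - (a0 - Q * am) * (Q * t - w)
        = (a1 * (1 - w * t) - a0 * (Q - w)) - Q * t * (a0 * (1 - w) - am * (Q - u))
          + Q * (am * u * t - am * w)"
      by (simp add: algebra_simps)
    also have "\<dots> = 0" using that by simp
    finally show ?thesis by simp
  qed
  have 3: "q ^ (2 * Suc i) = q ^ (2 * i) * q ^ 2" for i
    by (simp add: power2_eq_square)
  have "P (Suc N) $ Suc j = P N $ Suc j - q ^ (2 * N) * P N $ j"
    "P (Suc N) $ j = P N $ j - q ^ (2 * N) * (fps_X * P N) $ j"
    by (simp_all add: P_Suc)
  moreover note step[OF Suc.IH[of j, unfolded 3] 1 2]
  ultimately show ?case unfolding 3 by (simp only:)
qed

text \<open>The finite \<open>q\<close>-binomial theorem expresses the error of the partial product through a power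
  series in \<open>q\<close>, so the convergence is visible without completeness of the field.\<close>

lemma finite_q2_pochhammer_nth:
  "\<exists>r. (\<Prod>n<N. 1 - fps_const (q ^ (2 * n)) * fps_X) $ j =
         q2_pochhammer_coeff j + q ^ (2 * N) * fps_to_fls r"
proof (induction j)
  case 0
  have "(\<Prod>n<N. 1 - fps_const (q ^ (2 * n)) * fps_X) $ 0 = 1"
    by (simp add: fps_prod_nth0)
  thus ?case by (intro exI[of _ 0]) simp
next
  case (Suc j)
  let ?p = "\<lambda>j. (\<Prod>n<N. 1 - fps_const (q ^ (2 * n)) * fps_X) $ j"
  let ?i = "inverse (1 - q ^ (2 * Suc j))"
  obtain r where r: "?p j = q2_pochhammer_coeff j + q ^ (2 * N) * fps_to_fls r"
    using Suc by blast
  \<comment> \<open>The coefficients have no pole at q = 0, so the new remainder is again a power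
    series.\<close>
  have "\<exists>e. q2_pochhammer_coeff j = fps_to_fls e" for j
  proof (induction j)
    case (Suc j)
    then obtain e where "q2_pochhammer_coeff j = fps_to_fls e" by blast
    hence "q2_pochhammer_coeff (Suc j) =
        fps_to_fls (- (fps_X ^ (2 * j)) * inverse (1 - fps_X ^ (2 * Suc j)) * e)"
      by (simp add: fls_times_fps_to_fls fps_to_fls_power inverse_one_minus_q_power
          del: power_Suc mult_Suc_right)
    thus ?case by blast
  qed (auto intro: exI[of _ 1])
  then obtain e where e: "q2_pochhammer_coeff j = fps_to_fls e" by blast
  have "?p (Suc j) = ?p j * (q ^ (2 * N) - q ^ (2 * j)) * ?i"
    using finite_q2_pochhammer_nth_Suc[of N j] one_minus_q_power_nonzero[of "2 * Suc j", where ?'a = rat]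
    by (simp add: field_simps del: power_Suc mult_Suc_right)
  \<comment> \<open>The summand q^(2N) goes entirely into the remainder; -q^(2j) turns coefficient j
    into coefficient j+1.\<close>
  also have "\<dots> = q2_pochhammer_coeff (Suc j) + q ^ (2 * N) * (?i * (?p j - q ^ (2 * j) * fps_to_fls r))"
    unfolding r q2_pochhammer_coeff.simps by (simp add: algebra_simps del: power_Suc mult_Suc_right)
  also have "?i * (?p j - q ^ (2 * j) * fps_to_fls r) = fps_to_fls
      (inverse (1 - fps_X ^ (2 * Suc j)) * (e + fps_X ^ (2 * N) * r - fps_X ^ (2 * j) * r))"
    unfolding r e by (simp add: fls_times_fps_to_fls fps_to_fls_power inverse_one_minus_q_power
          del: power_Suc mult_Suc_right)
  finally show ?case by blast
qed

text \<open>Each coefficient of the composite is a fixed scalar (a power of c, or 0) times one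
  coefficient of the product in X, so the limit may be taken before substituting.\<close>

lemma q2_pochhammer_inf_monomial:
  assumes "d > 0"
  shows "q2_pochhammer_inf (fps_const c * fps_X ^ d) = q2_pochhammer_series oo fps_const c * fps_X ^ d"
proof (rule fps_ext)
  fix j
  let ?x = "fps_const c * fps_X ^ d"
  let ?p = "\<lambda>N. \<Prod>n<N. 1 - fps_const (q ^ (2 * n)) * fps_X"
  let ?s = "if d dvd j then c ^ (j div d) else 0"
  have "(\<Prod>n<N. 1 - fps_const (q ^ (2 * n)) * ?x) = ?p N oo ?x" for N
    using assms by (simp add: fps_compose_prod_distrib fps_compose_sub_distrib fps_compose_mult_distrib)
  hence "(\<Prod>n<N. 1 - fps_const (q ^ (2 * n)) * ?x) $ j = ?s * ?p N $ (j div d)" for N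
    using assms by (simp only: fps_nth_compose_monomial) simp
  moreover have "(q2_pochhammer_series oo ?x) $ j = ?s * q2_pochhammer_coeff (j div d)"
    using assms by (simp add: fps_nth_compose_monomial q2_pochhammer_series_def)
  moreover have "(\<lambda>N. ?s * ?p N $ (j div d)) \<longlonglongrightarrow> ?s * q2_pochhammer_coeff (j div d)"
  proof -
    have "\<forall>N. \<exists>r. ?p N $ (j div d) = q2_pochhammer_coeff (j div d) + q ^ (2 * N) * fps_to_fls r"
      using finite_q2_pochhammer_nth by blast
    from choice[OF this] obtain r where
      r: "\<And>N. ?p N $ (j div d) = q2_pochhammer_coeff (j div d) + q ^ (2 * N) * fps_to_fls (r N)"
      by blast
    have "q ^ (2 * N) = q ^ N * q ^ N" for N
      by (simp add: mult_2 power_add)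
    hence "?p N $ (j div d) = q2_pochhammer_coeff (j div d) + q ^ N * fps_to_fls (fps_X ^ N * r N)" for N
      unfolding r by (simp add: fls_times_fps_to_fls fps_to_fls_power mult.assoc)
    thus ?thesis by (rule fls_tendstoI)
  qed
  ultimately show "q2_pochhammer_inf ?x $ j = (q2_pochhammer_series oo ?x) $ j"
    by (simp add: q2_pochhammer_inf_def limI)
qed

text \<open>The recursion for the coefficients amounts to the functional equation E(X) = (1 - X)
  E(q^2 X). For n > 0 it gives L_n = -1 + q^(2n) L_n for the logarithmic derivative.\<close>

lemma fps_logder_q2_pochhammer_series:
  "fps_logder q2_pochhammer_series $ n = (if n = 0 then 0 else - inverse (1 - q ^ (2 * n)))"
proof (cases "n = 0")
  case False
  let ?E = q2_pochhammer_series
  let ?x = "fps_const (q\<^sup>2) * fps_X ^ 1"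
  have "?E $ j = ((1 - fps_X) * (?E oo ?x)) $ j" for j
  proof (cases j)
    case (Suc i)
    have "q2_pochhammer_coeff (Suc i) * (1 - q ^ (2 * Suc i)) = - (q ^ (2 * i)) * q2_pochhammer_coeff i"
      using one_minus_q_power_nonzero[of "2 * Suc i", where ?'a = rat]
      by (simp add: field_simps del: power_Suc mult_Suc_right)
    moreover have "((1 - fps_X) * (?E oo ?x)) $ Suc i = (?E oo ?x) $ Suc i - (?E oo ?x) $ i"
      by (simp add: algebra_simps)
    moreover have "(?E oo ?x) $ i = q2_pochhammer_coeff i * q ^ (2 * i)" for i
      unfolding fps_nth_compose_monomial[OF zero_less_one] by (simp add: q2_pochhammer_series_def power_mult)
    ultimately show ?thesis
      unfolding Suc by (simp add: q2_pochhammer_series_def algebra_simps del: q2_pochhammer_coeff.simps)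
  qed simp
  hence E: "?E = (1 - fps_X) * (?E oo ?x)" by (rule fps_ext)
  have "fps_logder (1 - fps_X :: rat fls fps) = Abs_fps (\<lambda>n. if n = 0 then 0 else - 1)" (is "_ = ?L")
  proof (rule fps_logder_eqI)
    show "?L * (1 - fps_X) = fps_X * fps_deriv (1 - fps_X)"
    proof (rule fps_ext)
      show "(?L * (1 - fps_X)) $ n = (fps_X * fps_deriv (1 - fps_X)) $ n" for n
        by (cases n) (simp_all add: algebra_simps)
    qed
  qed simp
  hence "fps_logder ?E = ?L + (fps_logder ?E oo ?x)"
    by (subst E) (simp add: fps_logder_mult fps_logder_compose_monomial[of _ 1, simplified])
  hence "fps_logder ?E $ n = (?L + (fps_logder ?E oo ?x)) $ n" by simp
  hence "fps_logder ?E $ n = - 1 + fps_logder ?E $ n * q ^ (2 * n)"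
    using False unfolding fps_add_nth fps_nth_compose_monomial[OF zero_less_one] by (simp add: power_mult)
  hence "fps_logder ?E $ n * (1 - q ^ (2 * n)) = - 1" by (simp add: algebra_simps)
  thus ?thesis
    using False one_minus_q_power_nonzero[of "2 * n", where ?'a = rat] by (simp add: field_simps)
qed simp

section \<open>Disk exponents\<close>

lemma fps_nth_0_powi:
  fixes F :: "'a::field fps"
  assumes "F $ 0 = 1"
  shows "(F powi n) $ 0 = 1"
  using assms by (simp add: power_int_def fps_nth_power_0)

section \<open>Truncated products and their logarithmic derivatives\<close>

definition disk_product :: "(nat \<Rightarrow> int \<Rightarrow> int) \<Rightarrow> nat \<Rightarrow> rat fls fps" where
  "disk_product n D = (\<Prod>d=1..D. \<Prod>k | n d k \<noteq> 0.
     q2_pochhammer_inf (fps_const ((- fls_X) powi k) * fps_X ^ d) powi (n d k))"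

text \<open>Row d as the Laurent polynomial with coefficients \<open>n d k\<close>, evaluated at
  (-q)^m.\<close>

definition disk_row :: "(nat \<Rightarrow> int \<Rightarrow> int) \<Rightarrow> nat \<Rightarrow> nat \<Rightarrow> rat fls" where
  "disk_row n d m = (\<Sum>k | n d k \<noteq> 0. of_int (n d k) * ((- q) powi k) ^ m)"

text \<open>For d dividing v, the contribution of the degree-d factors to coefficient v of the
  logarithmic derivative; the sign of -1/(1 - q^(2m)) is absorbed into the denominator.\<close>

definition disk_term :: "(nat \<Rightarrow> int \<Rightarrow> int) \<Rightarrow> nat \<Rightarrow> nat \<Rightarrow> rat fls" where
  "disk_term n v d = of_nat d * (disk_row n d (v div d) * inverse (q ^ (2 * (v div d)) - 1))"

lemma q2_pochhammer_inf_monomial_nth_0: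
  "d > 0 \<Longrightarrow> q2_pochhammer_inf (fps_const c * fps_X ^ d) $ 0 = 1"
  by (simp add: q2_pochhammer_inf_monomial)

lemma disk_product_nth_0: "disk_product n D $ 0 = 1"
proof -
  have "(\<Prod>k | n d k \<noteq> 0. (q2_pochhammer_inf (fps_const ((- fls_X) powi k) * fps_X ^ d) powi (n d k)) $ 0) = 1"
    if "d \<in> {1..D}" for d
    using that by (intro prod.neutral ballI fps_nth_0_powi q2_pochhammer_inf_monomial_nth_0) simp
  thus ?thesis unfolding disk_product_def fps_prod_nth0 by (intro prod.neutral) auto
qed

lemma fps_logder_q2_pochhammer_inf_monomial:
  assumes "d > 0" "v > 0"
  shows "fps_logder (q2_pochhammer_inf (fps_const c * fps_X ^ d)) $ v =
    (if d dvd v then of_nat d * (c ^ (v div d) * inverse (q ^ (2 * (v div d)) - 1)) else 0)"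
proof -
  have nz: "v div d \<noteq> 0" if "d dvd v"
    using that assms by (auto simp: dvd_div_eq_0_iff)
  have "- inverse (1 - x) = inverse (x - 1)" for x :: "rat fls"
    by (metis inverse_minus_eq minus_diff_eq)
  thus ?thesis
    using assms nz
    by (simp add: q2_pochhammer_inf_monomial fps_logder_compose_monomial fps_nth_compose_monomial
        fps_logder_q2_pochhammer_series mult.commute flip: fps_of_nat)
qed

text \<open>The double product becomes a double sum. A row of infinite support contributes nothing
  on either side, since its product is 1 and its sum 0 by convention.\<close>

lemma fps_logder_disk_product:
  assumes "v > 0"
  shows "fps_logder (disk_product n D) $ v = (\<Sum>d | d dvd v \<and> d \<le> D. disk_term n v d)"
proof -
  let ?x = "\<lambda>d k. q2_pochhammer_inf (fps_const ((- fls_X) powi k) * fps_X ^ d)"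
  have 0: "(\<Prod>k | n d k \<noteq> 0. ?x d k powi n d k) $ 0 \<noteq> 0" if "d \<in> {1..D}" for d
  proof -
    have "(\<Prod>k | n d k \<noteq> 0. (?x d k powi n d k) $ 0) = 1"
      using that by (intro prod.neutral ballI fps_nth_0_powi q2_pochhammer_inf_monomial_nth_0) simp
    thus ?thesis by (simp add: fps_prod_nth0)
  qed
  have row: "fps_logder (\<Prod>k | n d k \<noteq> 0. ?x d k powi n d k) $ v = (if d dvd v then disk_term n v d else 0)"
    if "d \<in> {1..D}" for d
  proof -
    have d: "d > 0" using that by simp
    have x0: "?x d k $ 0 = 1" for k using d by (rule q2_pochhammer_inf_monomial_nth_0)
    have "fps_logder (\<Prod>k | n d k \<noteq> 0. ?x d k powi n d k)
        = (\<Sum>k | n d k \<noteq> 0. fps_const (of_int (n d k)) * fps_logder (?x d k))"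
      by (subst fps_logder_prod) (simp_all add: fps_nth_0_powi fps_logder_power_int x0 fps_of_int)
    thus ?thesis
      using d assms
      by (simp add: fps_sum_nth fps_logder_q2_pochhammer_inf_monomial disk_term_def disk_row_def
          sum_distrib_left sum_distrib_right)
        (simp add: mult_ac)
  qed
  have "fps_logder (disk_product n D) $ v = (\<Sum>d=1..D. if d dvd v then disk_term n v d else 0)"
    unfolding disk_product_def
    by (subst fps_logder_prod, erule 0) (simp only: fps_sum_nth row cong: sum.cong)
  also have "\<dots> = (\<Sum>d | d dvd v \<and> d \<le> D. disk_term n v d)"
    using assms by (intro sum.mono_neutral_cong_right) (auto simp: Suc_le_eq intro: Nat.gr0I)
  finally show ?thesis .
qed

lemma fps_logder_disk_product':
  assumes "v > 0" "v \<le> D"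
  shows "fps_logder (disk_product n D) $ v = (\<Sum>d | d dvd v. disk_term n v d)"
proof -
  have "{d. d dvd v \<and> d \<le> D} = {d. d dvd v}"
    using assms by (auto dest: dvd_imp_le)
  thus ?thesis using assms by (simp add: fps_logder_disk_product)
qed

lemma canoe_wavefunction_nth_0: "canoe_wavefunction p $ 0 = 1"
  by (simp add: canoe_wavefunction_def)

text \<open>Factors of degree above j do not affect coefficient j, so the limit over D is reached at
  D = j. Comparing logarithmic derivatives then turns the limit into finite divisor sums.\<close>

lemma is_disk_exponents_iff:
  "is_disk_exponents p n \<longleftrightarrow> (\<forall>k. n 0 k = 0) \<and> (\<forall>d. finite {k. n d k \<noteq> 0}) \<and>
     (\<forall>v>0. fps_logder (canoe_wavefunction p) $ v = (\<Sum>d | d dvd v. disk_term n v d))"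
proof -
  let ?P = "canoe_wavefunction p"
  have stable: "disk_product n D $ j = disk_product n j $ j" if "j \<le> D" for j D
  proof (rule fps_nth_eq_if_logder_eq)
    fix v assume "v \<le> j"
    with that show "fps_logder (disk_product n D) $ v = fps_logder (disk_product n j) $ v"
      by (cases "v = 0") (simp_all add: fps_logder_disk_product')
  qed (simp_all add: disk_product_nth_0)
  have lim: "(\<lambda>D. disk_product n D $ j) \<longlonglongrightarrow> disk_product n j $ j" for j
    by (rule tendsto_eventually, rule eventually_mono[OF eventually_ge_at_top[of j]], rule stable)
  have "(\<forall>j. (\<lambda>D. disk_product n D $ j) \<longlonglongrightarrow> ?P $ j) \<longleftrightarrow> (\<forall>j. disk_product n j $ j = ?P $ j)"
  proof (rule all_cong1, rule iffI)
    fix j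
    assume "(\<lambda>D. disk_product n D $ j) \<longlonglongrightarrow> ?P $ j"
    with lim show "disk_product n j $ j = ?P $ j" by (rule LIMSEQ_unique)
  next
    fix j
    assume "disk_product n j $ j = ?P $ j"
    with lim[of j] show "(\<lambda>D. disk_product n D $ j) \<longlonglongrightarrow> ?P $ j" by (simp only:)
  qed
  also have "\<dots> \<longleftrightarrow> (\<forall>v>0. fps_logder ?P $ v = (\<Sum>d | d dvd v. disk_term n v d))"
  proof safe
    fix v :: nat
    assume eq: "\<forall>j. disk_product n j $ j = ?P $ j" and "v > 0"
    thus "fps_logder ?P $ v = (\<Sum>d | d dvd v. disk_term n v d)"
    proof (induction v rule: less_induct)
      case (less v)
      \<comment> \<open>\<open>disk_product n v\<close> changes with v, so the argument goes degree
        by degree: the logarithmic derivatives agree below v by induction, and the vanishing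
        discrepancy at v gives agreement there.\<close>
      have "of_nat v * (disk_product n v $ v - ?P $ v) = fps_logder (disk_product n v) $ v - fps_logder ?P $ v"
      proof (rule fps_nth_diff_eq_logder_diff)
        fix u assume "u < v"
        with less show "fps_logder (disk_product n v) $ u = fps_logder ?P $ u"
          by (cases "u = 0") (simp_all add: fps_logder_disk_product')
      qed (simp_all add: disk_product_nth_0 canoe_wavefunction_nth_0)
      with less.prems show ?case by (simp add: fps_logder_disk_product')
    qed
  next
    fix j
    assume eq: "\<forall>v>0. fps_logder ?P $ v = (\<Sum>d | d dvd v. disk_term n v d)"
    show "disk_product n j $ j = ?P $ j"
    proof (rule fps_nth_eq_if_logder_eq)
      fix v assume "v \<le> j"
      with eq show "fps_logder (disk_product n j) $ v = fps_logder ?P $ v"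
        by (cases "v = 0") (simp_all add: fps_logder_disk_product')
    qed (simp_all add: disk_product_nth_0 canoe_wavefunction_nth_0)
  qed
  finally show ?thesis unfolding is_disk_exponents_def disk_product_def by (simp only:)
qed

section \<open>Uniqueness of the disk exponents\<close>

lemma disk_row_1_nth:
  assumes "finite {k. n d k \<noteq> 0}"
  shows "disk_row n d 1 $$ k = of_int (n d k) * (- 1) powi k"
proof -
  have "disk_row n d 1 $$ k = (\<Sum>i | n d i \<noteq> 0. if i = k then of_int (n d k) * (- 1) powi k else 0)"
    unfolding disk_row_def fls_nth_sum
    by (intro sum.cong refl) (auto simp: minus_fls_X_powi fls_of_int)
  with assms show ?thesis by simp
qed

text \<open>In the divisor sum at v = d the proper divisors contribute equally by induction, so row
  d agrees at m = 1. Its coefficients at the powers of q are the exponents up to sign.\<close>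

lemma is_disk_exponents_unique:
  assumes n: "is_disk_exponents p n" and m: "is_disk_exponents p m"
  shows "n = m"
proof -
  have "n d = m d" for d
  proof (induction d rule: less_induct)
    case (less d)
    show ?case
    proof (cases "d = 0")
      case True
      with n m show ?thesis by (auto simp: is_disk_exponents_def)
    next
      case False
      have fin: "finite {e. e dvd d}" using False by simp
      have "(\<Sum>e | e dvd d. disk_term n d e) = (\<Sum>e | e dvd d. disk_term m d e)"
        using n m False by (simp add: is_disk_exponents_iff flip: neq0_conv)
      moreover have "disk_term n d e = disk_term m d e" if "e \<in> {e. e dvd d} - {d}" for e
      proof -
        have "e < d" using that False by (auto dest: dvd_imp_le simp: le_neq_implies_less)
        with less show ?thesis by (simp add: disk_term_def disk_row_def)
      qed
      ultimately have "disk_term n d d = disk_term m d d"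
        using sum.remove[OF fin, of d "disk_term n d"] sum.remove[OF fin, of d "disk_term m d"] by simp
      moreover have "q ^ 2 - 1 \<noteq> 0"
        using one_minus_q_power_nonzero[of 2, where ?'a = rat] by simp
      ultimately have row: "disk_row n d 1 = disk_row m d 1"
        using False by (simp add: disk_term_def)
      have "finite {k. n d k \<noteq> 0}" "finite {k. m d k \<noteq> 0}"
        using n m by (auto simp: is_disk_exponents_def)
      hence "of_int (n d k) * (- 1 :: rat) powi k = of_int (m d k) * (- 1) powi k" for k
        using row by (metis disk_row_1_nth)
      thus ?thesis by (simp add: fun_eq_iff)
    qed
  qed
  thus ?thesis by blast
qed

lemma disk_exponent_eqI: "is_disk_exponents p n \<Longrightarrow> disk_exponent p = n"
  unfolding disk_exponent_def by (rule the_equality) (auto intro: is_disk_exponents_unique)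

section \<open>Integrality of the truncated products and of the wave function\<close>

lemma int_fls_fps_mult:
  "(\<And>j. F $ j \<in> int_fls) \<Longrightarrow> (\<And>j. G $ j \<in> int_fls) \<Longrightarrow> (F * G) $ j \<in> int_fls"
  by (auto simp: fps_mult_nth)

lemma int_fls_fps_prod:
  "(\<And>i j. i \<in> I \<Longrightarrow> F i $ j \<in> int_fls) \<Longrightarrow> prod F I $ j \<in> int_fls"
  by (induction I arbitrary: j rule: infinite_finite_induct) (auto intro: int_fls_fps_mult)

lemma int_fls_fps_power: "(\<And>j. F $ j \<in> int_fls) \<Longrightarrow> (F ^ n) $ j \<in> int_fls"
  by (induction n arbitrary: j) (auto intro: int_fls_fps_mult)

lemma int_fls_fps_powi:
  assumes "\<And>j. F $ j \<in> int_fls" and "F $ 0 = 1"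
  shows "(F powi n) $ j \<in> int_fls"
proof -
  have "inverse F $ j \<in> int_fls" for j
    using assms by (intro fps_inverse_nth_in_subring) auto
  thus ?thesis using assms by (auto simp: power_int_def intro: int_fls_fps_power)
qed

lemma int_fls_disk_product: "disk_product n D $ j \<in> int_fls"
proof -
  have "(q2_pochhammer_inf (fps_const ((- fls_X) powi k) * fps_X ^ d) powi n d k) $ j \<in> int_fls"
    if "d > 0" for d k j
    using that
    by (intro int_fls_fps_powi q2_pochhammer_inf_monomial_nth_0)
      (auto simp: q2_pochhammer_inf_monomial fps_nth_compose_monomial q2_pochhammer_series_def
        intro!: int_fls_mult int_fls_q2_pochhammer_coeff)
  thus ?thesis unfolding disk_product_def by (intro int_fls_fps_prod) auto
qed

lemma int_fls_canoe_wavefunction: "canoe_wavefunction p $ v \<in> int_fls"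
proof -
  have "canoe_wavefunction p $ v =
      q powi ((1 - p) * (int v)\<^sup>2) * (\<Prod>i=1..v. inverse (1 - q ^ (2 * i)))"
    by (simp add: canoe_wavefunction_def divide_inverse flip: prod_inversef)
  also have "\<dots> \<in> int_fls"
    by (intro int_fls_mult int_fls_prod int_fls_X_powi int_fls_inverse_one_minus_q_power) auto
  finally show ?thesis .
qed

section \<open>The one-column part of the Kac generating series\<close>

lemma subset_mset_replicate_mset:
  "{m. m \<subseteq># replicate_mset v x} = (\<lambda>i. replicate_mset i x) ` {..v}"
  by (auto simp: replicate_mset_msubseteq_iff elim!: msubseteq_replicate_msetE)

text \<open>Setting all variables \<open>T\<^sub>i\<close> with \<open>i \<noteq> 1\<close> to zero.\<close>

definition T1_part :: "tseries \<Rightarrow> rat fls fps" where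
  "T1_part F = Abs_fps (\<lambda>v. F (replicate_mset v 1))"

lemma T1_part_nth [simp]: "T1_part F $ v = F (replicate_mset v 1)"
  by (simp add: T1_part_def)

text \<open>The sub-multisets of 1^v are the 1^i with i \<le> v, so the convolution restricts to the
  Cauchy product.\<close>

lemma T1_part_mult: "T1_part (tseries_mult F G) = T1_part F * T1_part G"
proof (rule fps_ext)
  fix v
  have inj: "inj_on (\<lambda>i. replicate_mset i (1::nat)) {..v}"
    by (auto simp: inj_on_def dest: arg_cong[of _ _ size])
  have "replicate_mset v (1::nat) - replicate_mset i 1 = replicate_mset (v - i) 1" for i
    by (auto simp: multiset_eq_iff)
  thus "T1_part (tseries_mult F G) $ v = (T1_part F * T1_part G) $ v"
    by (simp add: tseries_mult_def subset_mset_replicate_mset sum.reindex[OF inj] fps_mult_nth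
        atLeast0AtMost del: One_nat_def)
qed

lemma T1_part_power: "T1_part (tseries_power F k) = T1_part F ^ k"
proof (induction k)
  case 0
  show ?case by (rule fps_ext) (simp add: replicate_mset_eq_empty_iff)
qed (simp add: T1_part_mult)

text \<open>The truncation at \<open>size l\<close> becomes truncation at v, which is the bound in
  the coefficient formula for composition.\<close>

lemma T1_part_exp: "T1_part (tseries_exp F) = fps_exp 1 oo T1_part F"
proof (rule fps_ext)
  show "T1_part (tseries_exp F) $ v = (fps_exp 1 oo T1_part F) $ v" for v
    by (simp add: tseries_exp_def fps_compose_nth atLeast0AtMost flip: T1_part_power)
qed

lemma adams_replicate_mset:
  assumes "n > 0"
  shows "adams n F (replicate_mset v x) =
    (if n dvd v then fls_compose_power (F (replicate_mset (v div n) x)) n else 0)"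
proof -
  have "m = replicate_mset (v div n) x" if m: "repeat_mset n m = replicate_mset v x" for m
  proof (rule multiset_eqI)
    fix y
    have "n * count m y = (if y = x then v else 0)"
      using arg_cong[OF m, of "\<lambda>m. count m y"] by simp
    thus "count m y = count (replicate_mset (v div n) x) y"
      using assms by (auto split: if_splits)
  qed
  moreover have "n dvd v" if m: "repeat_mset n m = replicate_mset v x" for m
    using arg_cong[OF m, of size] by (metis dvd_triv_left size_repeat_mset size_replicate_mset)
  moreover have "repeat_mset n (replicate_mset (v div n) x) = replicate_mset v x" if "n dvd v"
    using that by (intro multiset_eqI) simp
  ultimately have "{m. repeat_mset n m = replicate_mset v x} =
      (if n dvd v then {replicate_mset (v div n) x} else {})"
    by auto
  thus ?thesis by (simp add: adams_def)
qed

text \<open>The conjugate of 1^v has the single part v.\<close>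

lemma partition_norm_replicate_mset: "partition_norm (replicate_mset v 1) = v\<^sup>2"
proof (cases "v = 0")
  case False
  have "filter_mset (\<lambda>x. i \<le> x) (replicate_mset v 1) = (if i \<le> 1 then replicate_mset v 1 else {#})" for i :: nat
    by (auto simp: multiset_eq_iff)
  hence "conjugate_part (replicate_mset v 1) i = (if i \<le> 1 then v else 0)" for i
    by (simp add: conjugate_part_def)
  hence "partition_norm (replicate_mset v 1) = (\<Sum>i=1..v. if i = 1 then v\<^sup>2 else 0)"
    unfolding partition_norm_def by (intro sum.cong) (auto simp: sum_mset_replicate_mset)
  thus ?thesis using False by simp
qed (simp add: partition_norm_def)

lemma b_partition_replicate_mset: "b_partition (replicate_mset v 1) x = (\<Prod>j=1..v. 1 - x ^ j)"
  by (simp add: b_partition_def)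

section \<open>The substitution q -> q^n in Laurent series\<close>

lemma fls_compose_power_compose:
  fixes f :: "'a::comm_ring_1 fls"
  assumes "a > 0" "b > 0"
  shows "fls_compose_power (fls_compose_power f a) b = fls_compose_power f (b * a)"
proof (rule fls_eqI)
  fix n
  have "int b dvd n \<and> int a dvd n div int b \<longleftrightarrow> int (b * a) dvd n"
    using assms by (auto simp: dvd_div_iff_mult mult.commute dest: dvd_mult_left dvd_mult_right)
  thus "fls_compose_power (fls_compose_power f a) b $$ n = fls_compose_power f (b * a) $$ n"
    using assms by (auto simp: fls_nth_compose_power zdiv_zmult2_eq)
qed

lemma fls_compose_power_sum:
  "d > 0 \<Longrightarrow> fls_compose_power (sum f I) d = (\<Sum>i\<in>I. fls_compose_power (f i) d)"
  by (induction I rule: infinite_finite_induct) simp_all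

lemma fls_compose_power_prod:
  fixes f :: "'b \<Rightarrow> 'a::idom fls"
  shows "d > 0 \<Longrightarrow> fls_compose_power (prod f I) d = (\<Prod>i\<in>I. fls_compose_power (f i) d)"
  by (induction I rule: infinite_finite_induct) simp_all

lemma fls_compose_power_eq_0_iff:
  "d > 0 \<Longrightarrow> fls_compose_power f d = 0 \<longleftrightarrow> f = 0"
proof
  assume "d > 0" "fls_compose_power f d = 0"
  hence "fls_compose_power f d $$ (int d * n) = 0" for n by simp
  with \<open>d > 0\<close> show "f = 0" by (intro fls_eqI) (simp add: fls_nth_compose_power)
qed auto

lemma fls_compose_power_inverse:
  fixes f :: "'a::field fls"
  assumes "d > 0"
  shows "fls_compose_power (inverse f) d = inverse (fls_compose_power f d)"
proof (cases "f = 0")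
  case False
  have "fls_compose_power (inverse f) d * fls_compose_power f d = fls_compose_power (inverse f * f) d"
    using assms by simp
  also have "\<dots> = 1" using False assms by simp
  finally show ?thesis by (metis inverse_unique inverse_inverse_eq mult.commute)
qed simp

lemma fls_compose_power_powi:
  fixes f :: "'a::field fls"
  shows "d > 0 \<Longrightarrow> fls_compose_power (f powi n) d = fls_compose_power f d powi n"
  by (simp add: power_int_def fls_compose_power_inverse)

lemma fls_compose_power_of_nat:
  "d > 0 \<Longrightarrow> fls_compose_power (of_nat n :: 'a::comm_ring_1 fls) d = of_nat n"
  by (simp add: fls_of_nat)

lemma fls_compose_power_X': "d > 0 \<Longrightarrow> fls_compose_power (fls_X :: 'a::field fls) d = fls_X ^ d"
  by (simp add: fls_X_power_conv_shift_1)

text \<open>Applied to coefficients, q -> q^d is a ring homomorphism fixing the integers, so it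
  respects products and X d/dX.\<close>

lemma fps_logder_compose_power_coeffs:
  fixes F :: "'a::field_char_0 fls fps"
  assumes "F $ 0 \<noteq> 0" and "d > 0"
  shows "fps_logder (Abs_fps (\<lambda>v. fls_compose_power (F $ v) d))
       = Abs_fps (\<lambda>v. fls_compose_power (fps_logder F $ v) d)" (is "fps_logder ?F = ?L")
proof (rule fps_logder_eqI)
  show "?L * ?F = fps_X * fps_deriv ?F"
  proof (rule fps_ext)
    fix v
    have "(?L * ?F) $ v = fls_compose_power ((fps_logder F * F) $ v) d"
      using assms by (simp add: fps_mult_nth fls_compose_power_sum)
    also have "\<dots> = (fps_X * fps_deriv ?F) $ v"
      using assms by (cases v) (simp_all add: fps_logder_mult_self fls_compose_power_of_nat del: of_nat_Suc)
    finally show "(?L * ?F) $ v = (fps_X * fps_deriv ?F) $ v" .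
  qed
  show "?F $ 0 \<noteq> 0" using assms by (simp add: fls_compose_power_eq_0_iff)
qed

lemma fps_logder_exp_compose:
  fixes f :: "'a::field_char_0 fps"
  assumes "f $ 0 = 0"
  shows "fps_logder (fps_exp 1 oo f) = fps_X * fps_deriv f"
  by (rule fps_logder_eqI) (use assms in \<open>simp_all add: fps_compose_deriv mult_ac\<close>)

lemma fls_compose_power_of_poly:
  fixes p :: "'a::field poly"
  assumes "m > 0"
  shows "fls_compose_power (fps_to_fls (fps_of_poly p)) m = (\<Sum>i\<le>degree p. fls_const (coeff p i) * fls_X ^ (m * i))"
proof (rule fls_eqI)
  fix k
  show "fls_compose_power (fps_to_fls (fps_of_poly p)) m $$ k =
      (\<Sum>i\<le>degree p. fls_const (coeff p i) * fls_X ^ (m * i)) $$ k"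
  proof (cases "k \<ge> 0 \<and> int m dvd k")
    case True
    then obtain i where i: "k = int (m * i)"
      using assms by (auto elim!: dvdE simp: zero_le_mult_iff intro: that[of "nat _"])
    have "(\<Sum>j\<le>degree p. fls_const (coeff p j) * fls_X ^ (m * j)) $$ k
        = (\<Sum>j\<le>degree p. if j = i then coeff p i else 0)"
      unfolding fls_nth_sum using assms by (intro sum.cong) (auto simp: i)
    also have "\<dots> = coeff p i" by (simp add: coeff_eq_0)
    finally show ?thesis using assms i by (simp add: fls_nth_compose_power)
  next
    case False
    hence "(\<Sum>i\<le>degree p. fls_const (coeff p i) * fls_X ^ (m * i)) $$ k = 0"
      unfolding fls_nth_sum by (intro sum.neutral) auto
    with False assms show ?thesis
      by (auto simp: fls_nth_compose_power neg_less_0_iff_less pos_imp_zdiv_neg_iff)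
  qed
qed

text \<open>The counterpart of \<open>disk_term\<close>: the contribution of 1^d after the
  substitutions q -> q^2 and T_1 -> -X/q, the latter producing (-q)^(-v).\<close>

definition Kac_term :: "(nat \<Rightarrow> rat poly) \<Rightarrow> nat \<Rightarrow> nat \<Rightarrow> rat fls" where
  "Kac_term a v d = of_nat d * (fls_compose_power (fps_to_fls (fps_of_poly (a d))) (2 * (v div d)) *
     inverse (- q) ^ v * inverse (q ^ (2 * (v div d)) - 1))"

text \<open>The logarithm of a plethystic exponential is a sum of Adams operations weighted by 1/n,
  so n = v/d contributes with weight v/n = d. The two substitutions then carry the Kac series to the
  wave function.\<close>

lemma fps_logder_canoe_wavefunction:
  assumes "is_refined_Kac_polynomials h A" and "v > 0"
  shows "fps_logder (canoe_wavefunction (2 - 2 * int h)) $ v =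
    (\<Sum>d | d dvd v. Kac_term (\<lambda>d. A (replicate_mset d 1)) v d)"
proof -
  define F :: tseries where
    "F = (\<lambda>m. if m = {#} then 0 else fps_to_fls (fps_of_poly (A m)) / (fls_X - 1))"
  define f where "f = T1_part (\<lambda>l. \<Sum>n=1..size l. adams n F l / of_nat n)"
  define K where "K = T1_part (plethystic_Exp F)"
  have K: "K = fps_exp 1 oo f"
    by (simp add: K_def f_def plethystic_Exp_def T1_part_exp)
  have f0: "f $ 0 = 0" by (simp add: f_def)
  have K0: "K $ 0 = 1" by (simp add: K)
  have Kv: "K $ v = q powi ((int h - 1) * (int v)\<^sup>2) / (\<Prod>j=1..v. 1 - inverse q ^ j)" for v
  proof -
    have "is_partition (replicate_mset v 1)" by (simp add: is_partition_def)
    with assms(1) have "q powi ((int h - 1) * int (partition_norm (replicate_mset v 1))) /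
        b_partition (replicate_mset v 1) (inverse q) = plethystic_Exp F (replicate_mset v 1)"
      unfolding is_refined_Kac_polynomials_def F_def by blast
    thus ?thesis
      unfolding partition_norm_replicate_mset b_partition_replicate_mset K_def T1_part_nth of_nat_power
      by (rule sym)
  qed
  define K2 where "K2 = Abs_fps (\<lambda>v. fls_compose_power (K $ v) 2)"
  have canoe: "canoe_wavefunction (2 - 2 * int h) = K2 oo fps_const (inverse (- q)) * fps_X ^ 1"
  proof (rule fps_ext)
    fix v
    have "1 - inverse (x ^ 2) ^ j = - (inverse x ^ (2 * j)) * (1 - x ^ (2 * j))" if "x \<noteq> 0" for j and x :: "rat fls"
    proof -
      have "inverse (x ^ 2) ^ j = inverse (x ^ (2 * j))" "inverse x ^ (2 * j) = inverse (x ^ (2 * j))"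
        by (simp_all add: power_mult power_inverse)
      thus ?thesis using that by (simp add: field_simps)
    qed
    hence 1: "1 - inverse (q ^ 2) ^ j = - (inverse q ^ (2 * j)) * (1 - q ^ (2 * j))" for j
      using fls_X_nonzero by blast
    \<comment> \<open>The exponents 2j sum to v^2 + v. The part (-q)^(-v) will cancel against T_1 ->
      -X/q, and q^(-v^2) corrects the quadratic exponent.\<close>
    have 2: "(\<Prod>j=1..v. - (inverse q ^ (2 * j))) = inverse (- q) ^ v * q powi (- (int v)\<^sup>2)"
    proof (induction v)
      case (Suc v)
      have "- (int (Suc v))\<^sup>2 = - (int v)\<^sup>2 + - int (2 * v + 1)"
        by (simp add: power2_eq_square algebra_simps)
      hence "q powi (- (int (Suc v))\<^sup>2) = q powi (- (int v)\<^sup>2) * q powi (- int (2 * v + 1))"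
        by (simp only: power_int_add[OF disjI1[OF fls_X_nonzero]])
      also have "q powi (- int (2 * v + 1)) = inverse q ^ (2 * v + 1)"
        by (simp only: power_int_minus power_int_of_nat power_inverse)
      finally have "q powi (- (int (Suc v))\<^sup>2) = q powi (- (int v)\<^sup>2) * inverse q ^ (2 * v + 1)" .
      with Suc show ?case by (simp add: algebra_simps)
    qed simp
    have "(K2 oo fps_const (inverse (- q)) * fps_X ^ 1) $ v = fls_compose_power (K $ v) 2 * inverse (- q) ^ v"
      unfolding fps_nth_compose_monomial[OF zero_less_one] by (simp add: K2_def)
    also have "fls_compose_power (K $ v) 2 =
        (q ^ 2) powi ((int h - 1) * (int v)\<^sup>2) / (\<Prod>j=1..v. 1 - inverse (q ^ 2) ^ j)"
      by (simp only: Kv divide_inverse fls_compose_power_mult fls_compose_power_inverse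
          fls_compose_power_prod fls_compose_power_powi fls_compose_power_X' fls_compose_power_diff
          fls_compose_power_1_left fls_compose_power_power zero_less_numeral simp_thms)
    also have "(\<Prod>j=1..v. 1 - inverse (q ^ 2) ^ j) =
        inverse (- q) ^ v * q powi (- (int v)\<^sup>2) * (\<Prod>j=1..v. 1 - q ^ (2 * j))"
      unfolding 1 prod.distrib 2 ..
    also have "(q ^ 2) powi ((int h - 1) * (int v)\<^sup>2) = q powi (2 * ((int h - 1) * (int v)\<^sup>2))"
      by (simp add: power_int_mult)
    also have "\<dots> = q powi ((1 - (2 - 2 * int h)) * (int v)\<^sup>2) * q powi (- (int v)\<^sup>2)"
      by (subst power_int_add [symmetric]) (simp_all add: algebra_simps)
    finally have "(K2 oo fps_const (inverse (- q)) * fps_X ^ 1) $ v =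
        q powi ((1 - (2 - 2 * int h)) * (int v)\<^sup>2) * q powi (- (int v)\<^sup>2) /
        (inverse (- q) ^ v * q powi (- (int v)\<^sup>2) * (\<Prod>j=1..v. 1 - q ^ (2 * j))) * inverse (- q) ^ v" .
    moreover have cancel: "x * p / (s * p * y) * s = x / y" if "p \<noteq> 0" "s \<noteq> 0" for x p s y :: "rat fls"
      using that by simp
    moreover have nz: "q powi (- (int v)\<^sup>2) \<noteq> 0" "inverse (- q) ^ v \<noteq> 0"
      by (simp_all add: power_int_eq_0_iff del: fls_X_power_int)
    ultimately show "canoe_wavefunction (2 - 2 * int h) $ v =
        (K2 oo fps_const (inverse (- q)) * fps_X ^ 1) $ v"
      by (simp only: canoe_wavefunction_def fps_nth_Abs_fps cancel[OF nz])
  qed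
  have Ad_F: "fls_compose_power (F (replicate_mset d 1)) m =
      fls_compose_power (fps_to_fls (fps_of_poly (A (replicate_mset d 1)))) m * inverse (q ^ m - 1)"
    if "d > 0" "m > 0" for d m
    using that by (simp add: F_def divide_inverse fls_compose_power_inverse fls_compose_power_X'
        replicate_mset_eq_empty_iff del: fls_compose_power_X)
  have pos: "d > 0" "v div d > 0" if "d dvd v" for d
    using that assms(2) by (auto elim!: dvdE intro: Nat.gr0I)
  have "fps_logder K $ v = of_nat v * f $ v"
    using assms(2) by (cases v) (simp_all add: K fps_logder_exp_compose f0)
  also have "\<dots> = (\<Sum>n=1..v. of_nat v * (adams n F (replicate_mset v 1) / of_nat n))"
    by (simp add: f_def sum_distrib_left)
  \<comment> \<open>The Adams operations with n not dividing v vanish at 1^v.\<close>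
  also have "\<dots> = (\<Sum>n | n dvd v. of_nat (v div n) * fls_compose_power (F (replicate_mset (v div n) 1)) n)"
    using assms(2)
    by (intro sum.mono_neutral_cong_right)
      (auto simp: adams_replicate_mset Suc_le_eq dvd_pos_nat dvd_imp_le of_nat_div)
  \<comment> \<open>The involution n -> v/n on the divisors of v.\<close>
  also have "\<dots> = (\<Sum>d | d dvd v. of_nat d * fls_compose_power (F (replicate_mset d 1)) (v div d))"
    using assms(2) by (intro sum.reindex_bij_witness[of _ "\<lambda>d. v div d" "\<lambda>d. v div d"]) auto
  finally have logder_K: "fps_logder K $ v =
    (\<Sum>d | d dvd v. of_nat d * fls_compose_power (F (replicate_mset d 1)) (v div d))" .
  have "fps_logder (canoe_wavefunction (2 - 2 * int h)) $ v =
      fls_compose_power (fps_logder K $ v) 2 * inverse (- q) ^ v"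
    unfolding canoe
    by (subst fps_logder_compose_monomial, simp add: K2_def K0, simp)
      (simp add: fps_nth_compose_monomial[OF zero_less_one, simplified] K2_def K0 fps_logder_compose_power_coeffs)
  also have "\<dots> = (\<Sum>d | d dvd v. of_nat d * fls_compose_power (F (replicate_mset d 1)) (2 * (v div d)) *
      inverse (- q) ^ v)"
    unfolding logder_K fls_compose_power_sum[OF zero_less_numeral] sum_distrib_right
    by (intro sum.cong refl) (simp add: fls_compose_power_of_nat fls_compose_power_compose pos)
  also have "\<dots> = (\<Sum>d | d dvd v. Kac_term (\<lambda>d. A (replicate_mset d 1)) v d)"
    by (intro sum.cong refl) (simp add: Kac_term_def Ad_F pos del: One_nat_def)
  finally show ?thesis .
qed

section \<open>Integrality and the comparison\<close>

text \<open>The factor \<open>1/(-q)^v\<close> between the two generating series forces the shift by \<open>d\<close> and the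
  parity condition.  Taking floors makes the definition total before integrality is known.\<close>

definition Kac_exponents :: "(nat \<Rightarrow> rat poly) \<Rightarrow> nat \<Rightarrow> int \<Rightarrow> int" where
  "Kac_exponents a d k =
     (if d > 0 \<and> even (k + int d) \<and> k + int d \<ge> 0
      then \<lfloor>coeff (a d) (nat ((k + int d) div 2))\<rfloor> else 0)"

lemma Kac_exponents_shift:
  "d > 0 \<Longrightarrow> Kac_exponents a d (2 * int i - int d) = \<lfloor>coeff (a d) i\<rfloor>"
  by (simp add: Kac_exponents_def)

lemma Kac_exponents_support:
  "{k. Kac_exponents a d k \<noteq> 0} \<subseteq> (\<lambda>i. 2 * int i - int d) ` {..degree (a d)}"
proof
  fix k assume "k \<in> {k. Kac_exponents a d k \<noteq> 0}"
  hence k: "even (k + int d)" "k + int d \<ge> 0" "coeff (a d) (nat ((k + int d) div 2)) \<noteq> 0"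
    by (auto simp: Kac_exponents_def split: if_splits)
  hence "nat ((k + int d) div 2) \<in> {..degree (a d)}" by (simp add: le_degree)
  moreover have "k = 2 * int (nat ((k + int d) div 2)) - int d" using k by auto
  ultimately show "k \<in> (\<lambda>i. 2 * int i - int d) ` {..degree (a d)}" by blast
qed

text \<open>Reindexing by k = 2i - d. The condition on g lets indices i with exponent 0 be included;
  a general g serves both the rows and their totals.\<close>

lemma sum_Kac_exponents:
  assumes "d > 0" and "\<And>k. g k 0 = 0"
  shows "(\<Sum>k | Kac_exponents a d k \<noteq> 0. g k (Kac_exponents a d k))
       = (\<Sum>i\<le>degree (a d). g (2 * int i - int d) \<lfloor>coeff (a d) i\<rfloor>)"
proof -
  have inj: "inj_on (\<lambda>i. 2 * int i - int d) {..degree (a d)}" by (auto simp: inj_on_def)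
  have "(\<Sum>k | Kac_exponents a d k \<noteq> 0. g k (Kac_exponents a d k))
      = (\<Sum>k\<in>(\<lambda>i. 2 * int i - int d) ` {..degree (a d)}. g k (Kac_exponents a d k))"
    using assms Kac_exponents_support[of a d] by (intro sum.mono_neutral_left) auto
  also have "\<dots> = (\<Sum>i\<le>degree (a d). g (2 * int i - int d) \<lfloor>coeff (a d) i\<rfloor>)"
    using assms(1) by (simp add: sum.reindex[OF inj] Kac_exponents_shift)
  finally show ?thesis .
qed

lemma disk_row_Kac_exponents:
  assumes "d > 0" "m > 0" and int: "\<And>i. coeff (a d) i \<in> \<int>"
  shows "disk_row (Kac_exponents a) d m =
    fls_compose_power (fps_to_fls (fps_of_poly (a d))) (2 * m) * inverse (- q) ^ (d * m)"
proof -
  \<comment> \<open>The sign disappears from the even power 2i, leaving the monomial q^i at q ->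
    q^(2m) times a shift independent of i.\<close>
  have pw: "((- q) powi (2 * int i - int d)) ^ m = q ^ (2 * m * i) * inverse (- q) ^ (d * m)" for i
  proof -
    have "x powi (2 * int i - int d) = x ^ (2 * i) * inverse x ^ d" if "x \<noteq> 0" for x :: "rat fls"
      using that power_int_of_nat[of x "2 * i"] by (simp add: power_int_diff divide_inverse power_inverse)
    hence "(- q) powi (2 * int i - int d) = (- q) ^ (2 * i) * inverse (- q) ^ d"
      by simp
    also have "(- q) ^ (2 * i) = q ^ (2 * i)" by simp
    finally show ?thesis by (simp add: power_mult_distrib mult_ac flip: power_mult)
  qed
  have "disk_row (Kac_exponents a) d m = (\<Sum>i\<le>degree (a d).
      of_int \<lfloor>coeff (a d) i\<rfloor> * ((- q) powi (2 * int i - int d)) ^ m)"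
    unfolding disk_row_def using assms(1)
    by (rule sum_Kac_exponents[where g = "\<lambda>k x. of_int x * ((- q) powi k) ^ m"]) simp
  also have "\<dots> = (\<Sum>i\<le>degree (a d). fls_const (coeff (a d) i) * q ^ (2 * m * i) * inverse (- q) ^ (d * m))"
    using int by (intro sum.cong refl) (simp add: pw fls_of_int mult.assoc)
  also have "\<dots> = fls_compose_power (fps_to_fls (fps_of_poly (a d))) (2 * m) * inverse (- q) ^ (d * m)"
    using assms(2) by (simp add: fls_compose_power_of_poly sum_distrib_right)
  finally show ?thesis .
qed

lemma disk_term_Kac_exponents:
  assumes "d dvd v" "v > 0" and "\<And>i. coeff (a d) i \<in> \<int>"
  shows "disk_term (Kac_exponents a) v d = Kac_term a v d"
proof -
  have "d > 0" using assms by (auto intro: Nat.gr0I)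
  moreover have "v div d > 0" using assms by (auto elim!: dvdE)
  ultimately show ?thesis
    using assms by (simp add: disk_term_def Kac_term_def disk_row_Kac_exponents mult.assoc)
qed

text \<open>Dividing out the factors of lower degree leaves \<open>Kac_term a d d\<close> as the coefficient of
  \<open>X^d\<close>, and the quotient has integral coefficients.\<close>

lemma refined_Kac_integral:
  assumes A: "is_refined_Kac_polynomials h A" and "d > 0"
  shows "coeff (A (replicate_mset d 1)) i \<in> \<int>"
  using assms(2)
proof (induction d arbitrary: i rule: less_induct)
  case (less d)
  define a where "a = (\<lambda>d. A (replicate_mset d 1))"
  let ?P = "canoe_wavefunction (2 - 2 * int h)" and ?R = "disk_product (Kac_exponents a) (d - 1)"
  have terms: "disk_term (Kac_exponents a) v e = Kac_term a v e"
    if "e dvd v" "v > 0" "e < d" for e v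
  proof (rule disk_term_Kac_exponents)
    have "e > 0" using that by (auto intro: Nat.gr0I)
    with less.IH that show "coeff (a e) i \<in> \<int>" for i by (simp add: a_def)
  qed (use that in simp_all)
  have P: "fps_logder ?P $ v = (\<Sum>e | e dvd v. Kac_term a v e)" if "v > 0" for v
    using fps_logder_canoe_wavefunction[OF A that] by (simp add: a_def)
  \<comment> \<open>Integrality below d is what identifies the truncated product with the Kac terms,
    since the exponents are floors.\<close>
  have R: "fps_logder ?R $ v = (\<Sum>e | e dvd v \<and> e < d. Kac_term a v e)" if "v > 0" for v
  proof -
    have "{e. e dvd v \<and> e \<le> d - 1} = {e. e dvd v \<and> e < d}" using less.prems by auto
    thus ?thesis using that by (simp add: fps_logder_disk_product terms)
  qed
  have "of_nat d * (?P $ d - ?R $ d) = fps_logder ?P $ d - fps_logder ?R $ d"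
  proof (rule fps_nth_diff_eq_logder_diff)
    fix v assume "v < d"
    show "fps_logder ?P $ v = fps_logder ?R $ v"
    proof (cases "v = 0")
      case False
      hence "{e. e dvd v \<and> e < d} = {e. e dvd v}" using \<open>v < d\<close> by (auto dest: dvd_imp_le)
      thus ?thesis using P[of v] R[of v] False by simp
    qed simp
  qed (simp_all add: canoe_wavefunction_nth_0 disk_product_nth_0)
  also have "fps_logder ?P $ d - fps_logder ?R $ d = Kac_term a d d"
  proof -
    have "e < d" if "e dvd d" "e \<noteq> d" for e
      using that less.prems dvd_imp_le[of e d] by simp
    hence "{e. e dvd d \<and> e < d} = {e. e dvd d} - {d}" by blast
    thus ?thesis using less.prems
      by (simp add: P R sum_diff1 del: One_nat_def)
  qed
  \<comment> \<open>The factor d in \<open>Kac_term a d d\<close> cancels the d on the left, so no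
    denominator d is left over.\<close>
  finally have eq: "?P $ d - ?R $ d =
      fls_compose_power (fps_to_fls (fps_of_poly (a d))) 2 * inverse (- q) ^ d * inverse (q ^ 2 - 1)"
    using less.prems by (simp add: Kac_term_def)
  have nz: "q ^ 2 - 1 \<noteq> 0"
    using one_minus_q_power_nonzero[of 2, where ?'a = rat] by simp
  have inv: "inverse (- q) ^ d * (- q) ^ d = 1"
    by (simp flip: power_mult_distrib)
  \<comment> \<open>Clearing denominators by an element of Z((q)) isolates the polynomial at q^2;
    its coefficient at 2i is coefficient i of the polynomial itself.\<close>
  have "(?P $ d - ?R $ d) * ((- q) ^ d * (q ^ 2 - 1)) =
      fls_compose_power (fps_to_fls (fps_of_poly (a d))) 2 *
      (inverse (- q) ^ d * (- q) ^ d) * (inverse (q ^ 2 - 1) * (q ^ 2 - 1))"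
    unfolding eq by (simp only: mult_ac)
  hence "fls_compose_power (fps_to_fls (fps_of_poly (a d))) 2 =
      (?P $ d - ?R $ d) * ((- q) ^ d * (q ^ 2 - 1))"
    by (simp only: inv left_inverse[OF nz] mult_1_right)
  also have "\<dots> \<in> int_fls"
    by (intro int_fls_mult int_fls_diff int_fls_canoe_wavefunction int_fls_disk_product
        int_fls_power int_fls_minus int_fls_X int_fls_1)
  finally have "fls_compose_power (fps_to_fls (fps_of_poly (a d))) 2 $$ (2 * int i) \<in> \<int>"
    by (rule int_flsD)
  thus ?case by (simp add: fls_nth_compose_power a_def)
qed

theorem proposition8p5:
  fixes h d :: nat
    and A :: "nat multiset \<Rightarrow> rat poly"
  assumes "h \<ge> 1"
    and "is_refined_Kac_polynomials h A"
    and "d \<ge> 1"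
  shows "poly (A (replicate_mset d 1)) 1 = of_int (disk_integer (2 - 2 * int h) d)"
proof -
  define a where "a = (\<lambda>d. A (replicate_mset d 1))"
  have int: "coeff (a e) i \<in> \<int>" if "e > 0" for e i
    using refined_Kac_integral[OF assms(2) that] by (simp add: a_def)
  \<comment> \<open>Both divisor sums now agree term by term, and uniqueness identifies the disk
    exponents.\<close>
  have "is_disk_exponents (2 - 2 * int h) (Kac_exponents a)"
    unfolding is_disk_exponents_iff
  proof (intro conjI allI impI)
    show "Kac_exponents a 0 k = 0" for k by (simp add: Kac_exponents_def)
    show "finite {k. Kac_exponents a e k \<noteq> 0}" for e
      by (rule finite_subset[OF Kac_exponents_support]) simp
    fix v :: nat assume v: "v > 0"
    have "disk_term (Kac_exponents a) v e = Kac_term a v e" if "e dvd v" for e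
    proof (rule disk_term_Kac_exponents)
      have "e > 0" using that v by (auto intro: Nat.gr0I)
      thus "coeff (a e) i \<in> \<int>" for i by (rule int)
    qed (use that v in simp_all)
    thus "fps_logder (canoe_wavefunction (2 - 2 * int h)) $ v =
        (\<Sum>e | e dvd v. disk_term (Kac_exponents a) v e)"
      using fps_logder_canoe_wavefunction[OF assms(2) v] by (simp add: a_def)
  qed
  hence "disk_exponent (2 - 2 * int h) = Kac_exponents a"
    by (rule disk_exponent_eqI)
  hence "of_int (disk_integer (2 - 2 * int h) d) =
      (\<Sum>k | Kac_exponents a d k \<noteq> 0. of_int (Kac_exponents a d k) :: rat)"
    by (simp add: disk_integer_def)
  also have "\<dots> = (\<Sum>i\<le>degree (a d). of_int \<lfloor>coeff (a d) i\<rfloor>)"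
    using assms(3) by (intro sum_Kac_exponents[where g = "\<lambda>k x. of_int x"]) simp_all
  \<comment> \<open>Integrality removes the floors, and the value at 1 is the sum of the
    coefficients.\<close>
  also have "\<dots> = poly (a d) 1"
    using int assms(3) by (simp add: poly_altdef)
  finally show ?thesis by (simp add: a_def)
qed

end
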